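(* Consider a time-sensitive network with delay-jitter map $\mathcal D$, propagated-burstiness map $\mathcal Y$, combined map $\mathcal G(z,d)=(\mathcal Y(d),\mathcal D(z))$, and set $\mathrm{Low}(\mathcal G)=\{(z,d) : (z,d)\le \mathcal G(z,d)\}$, all as described in the context. Let $(z^k,d^k)=\mathcal G^k(0,0)$, $k\ge 0$, be the SyncTFA sequence. If $\mathrm{Low}(\mathcal G)$ is bounded, then: 1. $\mathcal G$ has a unique fixpoint $(\bar z,\bar d)$; 2. $\bar d$ is a set of valid delay-jitter bounds at all nodes, and $\bar z$ gives valid burstiness bounds at all transit links; 3. the SyncTFA sequence $(z^k,d^k)$ converges to $(\bar z,\bar d)$. If $\mathrm{Low}(\mathcal G)$ is unbounded, then $\mathcal G$ has no fixpoint and the SyncTFA sequence does not converge.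
   Context: **Network.** A packet-switched network consists of devices with input ports, a switch fabric and output ports. Each input port contains a packetizer, which releases the data of a packet only when the packet has been entirely received. The packet then goes through the switch fabric to the scheduler of an output port and is serialized on the output line at the line transmission rate. One traffic class is considered; within it each scheduler is first-in-first-out and offers a rate-latency service curve. There are finitely many flows. Flow $f$ has a rate $r_f>0$ and a source burstiness $b_f>0$: over any time interval of duration $t$ its source emits at most $r_ft+b_f$ bits. The maximum packet size over all flows is $L_{\max}>0$. Local stability holds: at every node, the sum of the rates $r_f$ of the flows crossing it is at most the rate of its service curve. **Graph induced by flows.** Its vertices, called nodes, are the output ports; $\mathcal I$ is the set of nodes. There is an edge from $i$ to $j$ if there is a communication link from output port $i$ to the switch where $j$ resides and at least one flow uses this link and goes via $j$. The graph may contain cycles. A node is terminal if it leads to flow sinks, and non-terminal if it leads to other nodes. The path of a flow is a sequence of connected nodes, without repetition, whose last element is terminal. A flow is fresh at the first node of its path. $\mathcal L$ is the set of transit edges (transit links), i.e. the edges that lead to non-terminal nodes. $\mathrm{In}(i)\subset\mathcal L$ is the set of transit edges incident to (entering) node $i$. For $\ell\in\mathcal L$ and a flow $f$ carried by $\ell$, $\mathrm{Pred}_f(\ell)$ is the set of nodes crossed by $f$ that are upstream of $\ell$ (including the tail node of $\ell$). **Variables.** $z=(z_{\ell,f})$ is a vector of burstinesses, with one component for each $\ell\in\mathcal L$ and each transit flow $f$ carried by $\ell$. $d=(d_i^f)$ is a vector of delay-jitters, with one component for each node $i\in\mathcal I$ and each flow $f$ that uses $i$. All components are finite and nonnegative.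 For $M\subset\mathcal L$, $z_M$ is the collection of the components of $z$ with $\ell\in M$. Comparisons are coordinatewise. Fixpoints are finite, and convergence means convergence to a finite limit. **Maps.** $\mathcal D(z)=(\mathcal D_i(z_{\mathrm{In}(i)}))_{i\in\mathcal I}$, where $\mathcal D_i$ is the delay-jitter bound at node $i$ computed by Total Flow Analysis (network calculus). It takes into account all flows at $i$ (the burstinesses of fresh flows being fixed constants) and the effect of packetizers. Each of its coordinates is a minimum of affine functions of the input burstinesses, hence concave; it is isotonic (coordinatewise nondecreasing), and it is finite for finite arguments by local stability. Because there is a packetizer at each input port and $L_{\max}>0$, one has $\mathcal D(0)>0$ in every coordinate. The map $\mathcal Y$ is $\mathcal Y(d)_{\ell,f}=b_f+r_f\sum_{u\in\mathrm{Pred}_f(\ell)}d_u^f$. By network calculus, if $z$ are valid burstiness bounds then $\mathcal D(z)$ are valid delay-jitter bounds, and if $d$ are valid delay-jitter bounds then $\mathcal Y(d)$ are valid burstiness bounds. **Validity.** The network starts at time $0$ in an arbitrary state. The delay-jitter of a flow at a node is its worst-case delay minus its best-case delay, computed per bit from entrance to the packetizer to exit out of the output port. The worst-case burstiness of flow $f$ at a point is $\sup_{0\le s\le t}(R(t)-R(s)-r_f(t-s))$, where $R(t)$ is the number of bits of $f$ observed at this point between times $0$ and $t$. Bounds are valid if they are upper bounds on the worst-case delay-jitters at nodes and on the worst-case burstinesses of flows on transit links observed in $[0,t]$, for every $t\ge 0$. *)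

theory Defs
  imports "HOL-Analysis.Analysis"
begin

section \<open>Networks and the graph induced by flows\<close>

text \<open>
  Nodes are output ports. \<open>(i, j) \<in> conn N\<close> means that the line of port \<open>i\<close> ends at the
  switch where \<open>j\<close> resides; \<open>propag N (i, j)\<close> is the constant propagation time on that line.
  Port \<open>i\<close> serializes at rate \<open>line N i\<close> and offers the rate-latency service curve
  \<open>t \<mapsto> srate N i * max 0 (t - slat N i)\<close>; a constant time spent in the switch fabric is part
  of the latency. The amount of data is counted in bits.
\<close>

record ('n, 'f) network =
  nodes :: "'n set"
  conn :: "('n \<times> 'n) set"
  propag :: "'n \<times> 'n \<Rightarrow> real"
  line :: "'n \<Rightarrow> real"
  srate :: "'n \<Rightarrow> real"
  slat :: "'n \<Rightarrow> real"
  flows :: "'f set"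
  route :: "'f \<Rightarrow> 'n list"
  rate :: "'f \<Rightarrow> real"
  burst :: "'f \<Rightarrow> real"
  lmax :: real
  transit :: "('n \<times> 'n) set"

definition hops :: "'n list \<Rightarrow> ('n \<times> 'n) set" where
  "hops p = set (zip p (tl p))"

definition edges :: "('n, 'f) network \<Rightarrow> ('n \<times> 'n) set" where
  "edges N = {l \<in> conn N. \<exists>f \<in> flows N. l \<in> hops (route N f)}"

definition leads_to_node :: "('n, 'f) network \<Rightarrow> 'n \<Rightarrow> bool" where
  "leads_to_node N i \<longleftrightarrow> (\<exists>j. (i, j) \<in> edges N)"

text \<open>
  The sink of a flow is attached to the last node of its route, which is thereby terminal.

  The transit edges are the edges that lead to non-terminal nodes. If a terminal node is entered
  by edges, its delay bound also needs the burstiness of the flows carried by these edges, so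
  that such edges have to be counted as transit edges as well. Both conventions are admitted:
  \<open>transit N\<close> contains the edges into non-terminal nodes, and possibly further edges.
\<close>

definition well_formed :: "('n, 'f) network \<Rightarrow> bool" where
  "well_formed N \<longleftrightarrow>
     finite (flows N) \<and>
     (\<forall>f \<in> flows N. route N f \<noteq> [] \<and> distinct (route N f) \<and> set (route N f) \<subseteq> nodes N \<and>
        hops (route N f) \<subseteq> conn N \<and> rate N f > 0 \<and> burst N f > 0) \<and>
     (\<forall>i \<in> nodes N. line N i > 0 \<and> srate N i \<ge> 0 \<and> slat N i \<ge> 0) \<and>
     (\<forall>l \<in> edges N. propag N l \<ge> 0) \<and>
     lmax N > 0 \<and>
     {(i, j) \<in> edges N. leads_to_node N j} \<subseteq> transit N \<and> transit N \<subseteq> edges N"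

definition locally_stable :: "('n, 'f) network \<Rightarrow> bool" where
  "locally_stable N \<longleftrightarrow>
     (\<forall>i \<in> nodes N. (\<Sum>f | f \<in> flows N \<and> i \<in> set (route N f). rate N f) \<le> srate N i)"


section \<open>Executions\<close>

text \<open>
  In an execution, the bits of each flow are numbered in the order of their emission.
  Bit \<open>n\<close> of flow \<open>f\<close> enters the packetizer in front of node \<open>i\<close> at time \<open>enter \<omega> f n i\<close> and
  leaves output port \<open>i\<close> at time \<open>leave \<omega> f n i\<close>. Time \<open>0\<close> is the start of the network. Its
  state at time \<open>0\<close> is arbitrary: it consists of the bits that have a negative entrance time at
  some node where they have a nonnegative exit time.
\<close>

record ('n, 'f) execution =
  bits :: "'f \<Rightarrow> nat set"
  packet :: "'f \<Rightarrow> nat \<Rightarrow> nat"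
  enter :: "'f \<Rightarrow> nat \<Rightarrow> 'n \<Rightarrow> real"
  leave :: "'f \<Rightarrow> nat \<Rightarrow> 'n \<Rightarrow> real"

definition release :: "('n, 'f) execution \<Rightarrow> 'f \<Rightarrow> nat \<Rightarrow> 'n \<Rightarrow> real" where
  "release \<omega> f n i = Max {enter \<omega> f m i | m. m \<in> bits \<omega> f \<and> packet \<omega> f m = packet \<omega> f n}"

definition bits_at :: "('n, 'f) network \<Rightarrow> ('n, 'f) execution \<Rightarrow> 'n \<Rightarrow> ('f \<times> nat) set" where
  "bits_at N \<omega> i = {(f, n). f \<in> flows N \<and> i \<in> set (route N f) \<and> n \<in> bits \<omega> f}"

text \<open>
  Cumulative functions are left-continuous and vanish at time \<open>0\<close>. The backlog at time \<open>0\<close> is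
  counted as arriving at time \<open>0\<close>.
\<close>

definition arrived :: "('n, 'f) network \<Rightarrow> ('n, 'f) execution \<Rightarrow> 'n \<Rightarrow> real \<Rightarrow> ('f \<times> nat) set" where
  "arrived N \<omega> i t =
     {(f, n) \<in> bits_at N \<omega> i. 0 \<le> leave \<omega> f n i \<and> max 0 (release \<omega> f n i) < t}"

definition departed :: "('n, 'f) network \<Rightarrow> ('n, 'f) execution \<Rightarrow> 'n \<Rightarrow> real \<Rightarrow> ('f \<times> nat) set" where
  "departed N \<omega> i t = {(f, n) \<in> bits_at N \<omega> i. 0 \<le> leave \<omega> f n i \<and> leave \<omega> f n i < t}"

definition packets_ok :: "('n, 'f) network \<Rightarrow> ('n, 'f) execution \<Rightarrow> bool" where
  "packets_ok N \<omega> \<longleftrightarrow>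
     (\<forall>f \<in> flows N. mono_on (bits \<omega> f) (packet \<omega> f) \<and>
        (\<forall>p. finite {n \<in> bits \<omega> f. packet \<omega> f n = p} \<and>
             real (card {n \<in> bits \<omega> f. packet \<omega> f n = p}) \<le> lmax N))"

definition sources_ok :: "('n, 'f) network \<Rightarrow> ('n, 'f) execution \<Rightarrow> bool" where
  "sources_ok N \<omega> \<longleftrightarrow>
     (\<forall>f \<in> flows N. mono_on (bits \<omega> f) (\<lambda>n. enter \<omega> f n (hd (route N f))) \<and>
        (\<forall>s \<ge> 0. \<forall>t \<ge> 0.
           finite {n \<in> bits \<omega> f. enter \<omega> f n (hd (route N f)) \<in> {s..s + t}} \<and>
           real (card {n \<in> bits \<omega> f. enter \<omega> f n (hd (route N f)) \<in> {s..s + t}})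
             \<le> rate N f * t + burst N f))"

definition links_ok :: "('n, 'f) network \<Rightarrow> ('n, 'f) execution \<Rightarrow> bool" where
  "links_ok N \<omega> \<longleftrightarrow>
     (\<forall>f \<in> flows N. \<forall>(i, j) \<in> hops (route N f). \<forall>n \<in> bits \<omega> f.
        enter \<omega> f n j = leave \<omega> f n i + propag N (i, j))"

definition ports_ok :: "('n, 'f) network \<Rightarrow> ('n, 'f) execution \<Rightarrow> bool" where
  "ports_ok N \<omega> \<longleftrightarrow>
     (\<forall>i \<in> nodes N.
        \<comment> \<open>packetizer\<close>
        (\<forall>(f, n) \<in> bits_at N \<omega> i. release \<omega> f n i \<le> leave \<omega> f n i) \<and>
        \<comment> \<open>first-in-first-out\<close>
        (\<forall>(f, m) \<in> bits_at N \<omega> i. \<forall>(g, n) \<in> bits_at N \<omega> i.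
           release \<omega> f m i < release \<omega> g n i \<or> f = g \<and> m < n \<longrightarrow>
             leave \<omega> f m i < leave \<omega> g n i) \<and>
        \<comment> \<open>serialization at the line rate\<close>
        (\<forall>(f, m) \<in> bits_at N \<omega> i. \<forall>(g, n) \<in> bits_at N \<omega> i.
           (f, m) \<noteq> (g, n) \<longrightarrow> \<bar>leave \<omega> f m i - leave \<omega> g n i\<bar> \<ge> 1 / line N i) \<and>
        \<comment> \<open>rate-latency service curve\<close>
        (\<forall>t \<ge> 0. finite (arrived N \<omega> i t) \<and>
           (\<exists>s \<in> {0..t}. real (card (departed N \<omega> i t)) \<ge>
              real (card (arrived N \<omega> i s)) + srate N i * max 0 (t - s - slat N i))))"

definition executions :: "('n, 'f) network \<Rightarrow> ('n, 'f) execution set" where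
  "executions N = {\<omega>. packets_ok N \<omega> \<and> sources_ok N \<omega> \<and> links_ok N \<omega> \<and> ports_ok N \<omega>}"


section \<open>Worst-case burstiness and delay-jitter\<close>

text \<open>
  Worst cases are taken over a set \<open>\<Omega>\<close> of executions and over what is observed in \<open>[0, t]\<close>. A
  delay is observed if both the entrance and the exit of the bit are. Flows are observed on a
  link at the exit of its tail node.
\<close>

definition observed_bits :: "('n, 'f) execution \<Rightarrow> 'n \<times> 'n \<Rightarrow> 'f \<Rightarrow> real \<Rightarrow> real" where
  "observed_bits \<omega> l f t =
     real (card {n \<in> bits \<omega> f. 0 \<le> leave \<omega> f n (fst l) \<and> leave \<omega> f n (fst l) < t})"

definition worst_burstiness ::
  "('n, 'f) network \<Rightarrow> ('n, 'f) execution set \<Rightarrow> real \<Rightarrow> 'n \<times> 'n \<Rightarrow> 'f \<Rightarrow> ereal" where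
  "worst_burstiness N \<Omega> t l f =
     Sup {ereal (observed_bits \<omega> l f v - observed_bits \<omega> l f u - rate N f * (v - u)) | \<omega> u v.
            \<omega> \<in> \<Omega> \<and> 0 \<le> u \<and> u \<le> v \<and> v \<le> t}"

definition observed_delays ::
  "('n, 'f) execution set \<Rightarrow> real \<Rightarrow> 'n \<Rightarrow> 'f \<Rightarrow> ereal set" where
  "observed_delays \<Omega> t i f =
     {ereal (leave \<omega> f n i - enter \<omega> f n i) | \<omega> n.
        \<omega> \<in> \<Omega> \<and> n \<in> bits \<omega> f \<and> 0 \<le> enter \<omega> f n i \<and> leave \<omega> f n i \<le> t}"

definition delay_jitter :: "('n, 'f) execution set \<Rightarrow> real \<Rightarrow> 'n \<Rightarrow> 'f \<Rightarrow> ereal" where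
  "delay_jitter \<Omega> t i f = Sup (observed_delays \<Omega> t i f) - Inf (observed_delays \<Omega> t i f)"


section \<open>Vectors of burstinesses and of delay-jitters\<close>

text \<open>
  Vectors are extensional functions on their index sets, so that equality of vectors is equality
  of functions, and the topology of pointwise convergence is the coordinatewise one.
\<close>

type_synonym ('n, 'f) bvec = "('n \<times> 'n) \<times> 'f \<Rightarrow> real"
type_synonym ('n, 'f) dvec = "'n \<times> 'f \<Rightarrow> real"

definition bidx :: "('n, 'f) network \<Rightarrow> (('n \<times> 'n) \<times> 'f) set" where
  "bidx N = {(l, f). l \<in> transit N \<and> f \<in> flows N \<and> l \<in> hops (route N f)}"

definition didx :: "('n, 'f) network \<Rightarrow> ('n \<times> 'f) set" where
  "didx N = {(i, f). f \<in> flows N \<and> i \<in> set (route N f)}"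

text \<open>The components of \<open>z\<close> on the transit edges that enter node \<open>i\<close>.\<close>

definition bidx_in :: "('n, 'f) network \<Rightarrow> 'n \<Rightarrow> (('n \<times> 'n) \<times> 'f) set" where
  "bidx_in N i = {(l, f) \<in> bidx N. snd l = i}"

definition nonneg_vectors :: "'k set \<Rightarrow> ('k \<Rightarrow> real) set" where
  "nonneg_vectors K = K \<rightarrow>\<^sub>E {0..}"

definition zero_vector :: "'k set \<Rightarrow> 'k \<Rightarrow> real" where
  "zero_vector K = (\<lambda>k\<in>K. 0)"

definition states :: "('n, 'f) network \<Rightarrow> (('n, 'f) bvec \<times> ('n, 'f) dvec) set" where
  "states N = nonneg_vectors (bidx N) \<times> nonneg_vectors (didx N)"

definition bounds_burstiness ::
  "('n, 'f) network \<Rightarrow> ('n, 'f) execution set \<Rightarrow> real \<Rightarrow> ('n, 'f) bvec \<Rightarrow> bool" where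
  "bounds_burstiness N \<Omega> t z \<longleftrightarrow> (\<forall>(l, f) \<in> bidx N. worst_burstiness N \<Omega> t l f \<le> ereal (z (l, f)))"

definition bounds_jitter ::
  "('n, 'f) network \<Rightarrow> ('n, 'f) execution set \<Rightarrow> real \<Rightarrow> ('n, 'f) dvec \<Rightarrow> bool" where
  "bounds_jitter N \<Omega> t d \<longleftrightarrow> (\<forall>(i, f) \<in> didx N. delay_jitter \<Omega> t i f \<le> ereal (d (i, f)))"

definition valid_burstiness ::
  "('n, 'f) network \<Rightarrow> ('n, 'f) execution set \<Rightarrow> ('n, 'f) bvec \<Rightarrow> bool" where
  "valid_burstiness N \<Omega> z \<longleftrightarrow> (\<forall>t \<ge> 0. bounds_burstiness N \<Omega> t z)"

definition valid_jitter ::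
  "('n, 'f) network \<Rightarrow> ('n, 'f) execution set \<Rightarrow> ('n, 'f) dvec \<Rightarrow> bool" where
  "valid_jitter N \<Omega> d \<longleftrightarrow> (\<forall>t \<ge> 0. bounds_jitter N \<Omega> t d)"


section \<open>Total Flow Analysis\<close>

text \<open>
  A family of local delay-jitter maps assigns to every node \<open>i\<close>, to the burstinesses of the
  transit flows that enter \<open>i\<close>, and to every flow that uses \<open>i\<close> a delay-jitter bound. An affine
  function is given by its constant (which covers the fixed burstinesses of the fresh flows) and
  its coefficients.
\<close>

type_synonym ('n, 'f) local_maps = "'n \<Rightarrow> ('n, 'f) bvec \<Rightarrow> 'f \<Rightarrow> real"

definition min_affine_on :: "'k set \<Rightarrow> (('k \<Rightarrow> real) \<Rightarrow> real) \<Rightarrow> bool" where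
  "min_affine_on K g \<longleftrightarrow>
     (\<exists>A :: (real \<times> ('k \<Rightarrow> real)) set. finite A \<and> A \<noteq> {} \<and>
        (\<forall>x \<in> nonneg_vectors K. g x = Min ((\<lambda>(c, a). c + (\<Sum>k\<in>K. a k * x k)) ` A)))"

definition isotonic_on :: "'k set \<Rightarrow> (('k \<Rightarrow> real) \<Rightarrow> real) \<Rightarrow> bool" where
  "isotonic_on K g \<longleftrightarrow>
     (\<forall>x \<in> nonneg_vectors K. \<forall>y \<in> nonneg_vectors K. (\<forall>k \<in> K. x k \<le> y k) \<longrightarrow> g x \<le> g y)"

definition tfa_local_maps :: "('n, 'f) network \<Rightarrow> ('n, 'f) local_maps \<Rightarrow> bool" where
  "tfa_local_maps N D \<longleftrightarrow>
     (\<forall>(i, f) \<in> didx N.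
        min_affine_on (bidx_in N i) (\<lambda>x. D i x f) \<and>
        isotonic_on (bidx_in N i) (\<lambda>x. D i x f) \<and>
        D i (zero_vector (bidx_in N i)) f > 0)"

definition jitter_map ::
  "('n, 'f) network \<Rightarrow> ('n, 'f) local_maps \<Rightarrow> ('n, 'f) bvec \<Rightarrow> ('n, 'f) dvec" where
  "jitter_map N D z = (\<lambda>(i, f)\<in>didx N. D i (restrict z (bidx_in N i)) f)"

definition pred_nodes :: "('n, 'f) network \<Rightarrow> 'f \<Rightarrow> 'n \<times> 'n \<Rightarrow> 'n set" where
  "pred_nodes N f l =
     {route N f ! k | k m. k \<le> m \<and> m < length (route N f) \<and> route N f ! m = fst l}"

definition burstiness_map ::
  "('n, 'f) network \<Rightarrow> ('n, 'f) dvec \<Rightarrow> ('n, 'f) bvec" where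
  "burstiness_map N d =
     (\<lambda>(l, f)\<in>bidx N. burst N f + rate N f * (\<Sum>u\<in>pred_nodes N f l. d (u, f)))"

text \<open>
  The network calculus results that connect the maps to the executions. They apply to the
  network observed up to any time \<open>t\<close>.
\<close>

definition jitter_map_sound ::
  "('n, 'f) network \<Rightarrow> ('n, 'f) execution set \<Rightarrow> ('n, 'f) local_maps \<Rightarrow> bool" where
  "jitter_map_sound N \<Omega> D \<longleftrightarrow>
     (\<forall>t \<ge> 0. \<forall>z \<in> nonneg_vectors (bidx N).
        bounds_burstiness N \<Omega> t z \<longrightarrow> bounds_jitter N \<Omega> t (jitter_map N D z))"

definition burstiness_map_sound ::
  "('n, 'f) network \<Rightarrow> ('n, 'f) execution set \<Rightarrow> bool" where
  "burstiness_map_sound N \<Omega> \<longleftrightarrow>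
     (\<forall>t \<ge> 0. \<forall>d \<in> nonneg_vectors (didx N).
        bounds_jitter N \<Omega> t d \<longrightarrow> bounds_burstiness N \<Omega> t (burstiness_map N d))"

definition combined_map ::
  "('n, 'f) network \<Rightarrow> ('n, 'f) local_maps \<Rightarrow>
   ('n, 'f) bvec \<times> ('n, 'f) dvec \<Rightarrow> ('n, 'f) bvec \<times> ('n, 'f) dvec" where
  "combined_map N D = (\<lambda>(z, d). (burstiness_map N d, jitter_map N D z))"

definition fixpoint_states ::
  "('n, 'f) network \<Rightarrow> ('n, 'f) local_maps \<Rightarrow> (('n, 'f) bvec \<times> ('n, 'f) dvec) set" where
  "fixpoint_states N D = {x \<in> states N. combined_map N D x = x}"

definition low ::
  "('n, 'f) network \<Rightarrow> ('n, 'f) local_maps \<Rightarrow> (('n, 'f) bvec \<times> ('n, 'f) dvec) set" where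
  "low N D = {x \<in> states N.
     (\<forall>k \<in> bidx N. fst x k \<le> fst (combined_map N D x) k) \<and>
     (\<forall>k \<in> didx N. snd x k \<le> snd (combined_map N D x) k)}"

definition bounded_states ::
  "('n, 'f) network \<Rightarrow> (('n, 'f) bvec \<times> ('n, 'f) dvec) set \<Rightarrow> bool" where
  "bounded_states N S \<longleftrightarrow>
     (\<exists>B. \<forall>(z, d) \<in> S. (\<forall>k \<in> bidx N. \<bar>z k\<bar> \<le> B) \<and> (\<forall>k \<in> didx N. \<bar>d k\<bar> \<le> B))"

definition sync_tfa ::
  "('n, 'f) network \<Rightarrow> ('n, 'f) local_maps \<Rightarrow> nat \<Rightarrow> ('n, 'f) bvec \<times> ('n, 'f) dvec" where
  "sync_tfa N D k = (combined_map N D ^^ k) (zero_vector (bidx N), zero_vector (didx N))"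

end

theory Submission
  imports Defs
begin

text \<open>
  The combined map is isotonic and concave, and positive at \<open>0\<close>. Hence if \<open>x\<close> is a fixpoint, \<open>y\<close> is
  in \<open>low N D\<close> and \<open>c y \<le> x\<close> with \<open>0 \<le> c < 1\<close>, then the inequality is strict in every coordinate;
  increasing \<open>c\<close> gives \<open>y \<le> x\<close>. A fixpoint is thus the greatest element of \<open>low N D\<close>, which gives
  uniqueness and makes \<open>low N D\<close> bounded. Conversely, the SyncTFA sequence is nondecreasing and stays
  in \<open>low N D\<close>, so it converges if this set is bounded, and by continuity any limit is a fixpoint.
  The worst cases observed in \<open>[0, t]\<close> are finite and form an element of \<open>low N D\<close>, so the fixpoint
  bounds them for every \<open>t\<close>.
\<close>

section \<open>Vectors and minima of affine functions\<close>

text \<open>Functions carry the product topology, so each limit of vectors below can be taken one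
  coordinate at a time.\<close>

lemma tendsto_fun_iff:
  fixes X :: "'c \<Rightarrow> 'k \<Rightarrow> 'a::topological_space"
  shows "(X \<longlongrightarrow> x) F \<longleftrightarrow> (\<forall>k. ((\<lambda>n. X n k) \<longlongrightarrow> x k) F)"
  using limitin_componentwise[of "\<lambda>_. euclidean" UNIV X x F]
  by (simp add: euclidean_product_topology)

lemmas tendsto_funI = tendsto_fun_iff[THEN iffD2, rule_format]
lemmas tendsto_funD = tendsto_fun_iff[THEN iffD1, rule_format]

lemma tendsto_Min_image:
  fixes f :: "'a \<Rightarrow> 'c \<Rightarrow> real"
  assumes "finite A" "A \<noteq> {}" "\<And>a. a \<in> A \<Longrightarrow> (f a \<longlongrightarrow> l a) F"
  shows "((\<lambda>n. Min ((\<lambda>a. f a n) ` A)) \<longlongrightarrow> Min (l ` A)) F"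
  using assms
proof (induction rule: finite_ne_induct)
  case (singleton a)
  then show ?case by simp
next
  case (insert a A)
  then show ?case by (simp add: tendsto_min)
qed

text \<open>
  Otherwise the largest \<open>c\<close> with \<open>c y \<le> x\<close> would be less than \<open>1\<close>, with equality at some coordinate.
\<close>

lemma ray_comparison:
  fixes x y :: "'k \<Rightarrow> real"
  assumes "finite K" and nonneg: "\<And>k. k \<in> K \<Longrightarrow> 0 \<le> x k"
    and step: "\<And>c k. 0 \<le> c \<Longrightarrow> c < 1 \<Longrightarrow> \<forall>j\<in>K. c * y j \<le> x j \<Longrightarrow> k \<in> K \<Longrightarrow> c * y k < x k"
  shows "\<forall>k\<in>K. y k \<le> x k"
proof (rule ccontr)
  define J where "J = {k \<in> K. x k < y k}"
  assume "\<not> ?thesis"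
  then have J: "finite J" "J \<noteq> {}"
    using assms(1) by (auto simp: J_def not_le)
  \<comment> \<open>On \<open>J\<close> one has y > x >= 0, so the quotients are legitimate; their
    minimum is the largest factor that respects all the violated coordinates.\<close>
  define c where "c = Min ((\<lambda>k. x k / y k) ` J)"
  have "c \<in> (\<lambda>k. x k / y k) ` J"
    unfolding c_def using J by (intro Min_in) auto
  then obtain k where k: "k \<in> K" "x k < y k" "c = x k / y k"
    by (auto simp: J_def)
  have c: "0 \<le> c" "c < 1"
    using k nonneg[of k] by (auto simp: divide_less_eq)
  have "c * y j \<le> x j" if j: "j \<in> K" for j
  proof (cases "j \<in> J")
    case True
    then have "c \<le> x j / y j"
      unfolding c_def using J by (intro Min_le) auto
    then show ?thesis
      using True nonneg[OF j] by (simp add: J_def field_simps)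
  next
    case False
    then have "y j \<le> x j" using j by (simp add: J_def not_less)
    \<comment> \<open>The sign of \<open>y j\<close> is not known: if it is negative, then c * y j
      <= 0 <= x j; otherwise scaling by c < 1 only decreases it.\<close>
    then show ?thesis
      using nonneg[OF j] c
      by (smt (verit) mult_left_le_one_le mult_nonneg_nonpos)
  qed
  then have "c * y k < x k" using step[OF c] k by blast
  then show False using k nonneg[of k] by simp
qed

section \<open>Isotonic functions and minima of affine functions\<close>

lemma isotonic_onD:
  assumes "isotonic_on K g" "x \<in> nonneg_vectors K" "y \<in> nonneg_vectors K"
    and "\<And>k. k \<in> K \<Longrightarrow> x k \<le> y k"
  shows "g x \<le> g y"
  using assms by (auto simp: isotonic_on_def)

text \<open>Concavity on the segment from 0 to x. An affine piece satisfies the relation with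
  equality, and \<open>g\<close> is below every piece at both endpoints.\<close>

lemma min_affine_on_concave_ray:
  assumes g: "min_affine_on K g" and x: "x \<in> nonneg_vectors K" and c: "0 \<le> c" "c \<le> 1"
  shows "c * g x + (1 - c) * g (zero_vector K) \<le> g (\<lambda>k\<in>K. c * x k)"
proof -
  obtain A where A: "finite A" "A \<noteq> {}"
    and gA: "\<forall>x\<in>nonneg_vectors K. g x = Min ((\<lambda>(b, a). b + (\<Sum>k\<in>K. a k * x k)) ` A)"
    using g unfolding min_affine_on_def by blast
  define h where "h = (\<lambda>(b, a) x. b + (\<Sum>k\<in>K. a k * (x k :: real)))"
  have gh: "g x = Min ((\<lambda>p. h p x) ` A)" if "x \<in> nonneg_vectors K" for x
    using gA that by (simp add: h_def case_prod_beta')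
  have mem: "(\<lambda>k\<in>K. c * x k) \<in> nonneg_vectors K" "zero_vector K \<in> nonneg_vectors K"
    using x c by (auto simp: nonneg_vectors_def zero_vector_def PiE_iff)
  have "c * g x + (1 - c) * g (zero_vector K) \<le> h p (\<lambda>k\<in>K. c * x k)" if p: "p \<in> A" for p
  proof -
    have "g x \<le> h p x" "g (zero_vector K) \<le> h p (zero_vector K)"
      using A p x mem by (auto simp: gh)
    then have "c * g x + (1 - c) * g (zero_vector K) \<le> c * h p x + (1 - c) * h p (zero_vector K)"
      using c by (intro add_mono mult_left_mono) auto
    also have "\<dots> = h p (\<lambda>k\<in>K. c * x k)"
      by (cases p) (simp add: h_def zero_vector_def algebra_simps sum_distrib_left cong: sum.cong)
    finally show ?thesis .
  qed
  then show ?thesis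
    using A mem by (simp add: gh)
qed

text \<open>Each affine piece is continuous. The representation of \<open>g\<close> is available on
  nonnegative vectors only, so the sequence and its limit must both lie there.\<close>

lemma min_affine_on_tendsto:
  assumes g: "min_affine_on K g"
    and X: "\<And>n. X n \<in> nonneg_vectors K" and x: "x \<in> nonneg_vectors K"
    and lim: "\<And>k. k \<in> K \<Longrightarrow> (\<lambda>n. X n k) \<longlonglongrightarrow> x k"
  shows "(\<lambda>n. g (X n)) \<longlonglongrightarrow> g x"
proof -
  obtain A where A: "finite A" "A \<noteq> {}"
    and gA: "\<forall>x\<in>nonneg_vectors K. g x = Min ((\<lambda>(b, a). b + (\<Sum>k\<in>K. a k * x k)) ` A)"
    using g unfolding min_affine_on_def by blast
  have gh: "g x = Min ((\<lambda>p. fst p + (\<Sum>k\<in>K. snd p k * x k)) ` A)" if "x \<in> nonneg_vectors K" for x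
    using gA that by (simp add: case_prod_beta')
  show ?thesis
    unfolding gh[OF X] gh[OF x]
    by (rule tendsto_Min_image[OF A]) (intro tendsto_intros lim)
qed

text \<open>Weak inequalities pass to the limit. Outside \<open>K\<close> the sequence is constantly
  \<open>undefined\<close>, so the limit is again extensional.\<close>

lemma nonneg_vectors_closed:
  assumes "\<And>n. X n \<in> nonneg_vectors K" and "X \<longlonglongrightarrow> x"
  shows "x \<in> nonneg_vectors K"
proof -
  have lim: "(\<lambda>n. X n k) \<longlonglongrightarrow> x k" for k
    using assms(2) by (rule tendsto_funD)
  have "0 \<le> x k" if "k \<in> K" for k
    using assms(1) that by (intro LIMSEQ_le_const[OF lim]) (auto simp: nonneg_vectors_def PiE_iff)
  moreover have "x k = undefined" if "k \<notin> K" for k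
  proof -
    have "(\<lambda>n. X n k) = (\<lambda>n. undefined)"
      using assms(1) that by (force simp: nonneg_vectors_def PiE_iff extensional_def)
    then show ?thesis using lim[of k] by (metis LIMSEQ_const_iff)
  qed
  ultimately show ?thesis
    by (auto simp: nonneg_vectors_def PiE_iff extensional_def)
qed

lemma nonneg_vectors_bounded_incseq_convergent:
  assumes X: "\<And>n. X n \<in> nonneg_vectors K"
    and inc: "\<And>n k. k \<in> K \<Longrightarrow> X n k \<le> X (Suc n) k"
    and bound: "\<And>n k. k \<in> K \<Longrightarrow> X n k \<le> B"
  shows "convergent X"
proof -
  have "convergent (\<lambda>n. X n k)" for k
  proof (cases "k \<in> K")
    case True
    then have "incseq (\<lambda>n. X n k)" using inc by (intro incseq_SucI) auto
    then show ?thesis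
      using incseq_convergent[of "\<lambda>n. X n k" B] True bound unfolding convergent_def by metis
  next
    case False
    then have "(\<lambda>n. X n k) = (\<lambda>n. undefined)"
      using X by (force simp: nonneg_vectors_def PiE_iff extensional_def)
    then show ?thesis by (simp add: convergent_const)
  qed
  then show ?thesis
    unfolding convergent_def tendsto_fun_iff by metis
qed

text \<open>Cells of length \<delta> contain at most one point each, and the cells that meet [0, t)
  are numbered from 0 to the floor of t / \<delta>.\<close>

lemma card_spaced_le:
  fixes p :: "'a \<Rightarrow> real"
  assumes "\<delta> > 0" and range: "\<And>a. a \<in> S \<Longrightarrow> 0 \<le> p a \<and> p a < t"
    and spaced: "\<And>a b. a \<in> S \<Longrightarrow> b \<in> S \<Longrightarrow> a \<noteq> b \<Longrightarrow> \<delta> \<le> \<bar>p a - p b\<bar>"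
  shows "card S \<le> Suc (nat \<lfloor>t / \<delta>\<rfloor>)"
proof -
  let ?q = "\<lambda>a. nat \<lfloor>p a / \<delta>\<rfloor>"
  have "inj_on ?q S"
  proof (rule inj_onI, rule ccontr)
    fix a b assume ab: "a \<in> S" "b \<in> S" "?q a = ?q b" "a \<noteq> b"
    \<comment> \<open>Both floors are nonnegative, so \<open>nat\<close> loses no
      information.\<close>
    then have "\<lfloor>p a / \<delta>\<rfloor> = \<lfloor>p b / \<delta>\<rfloor>"
      using range assms(1) by (simp add: nat_eq_iff)
    then have "\<bar>p a / \<delta> - p b / \<delta>\<bar> < 1" by linarith
    then have "\<bar>p a - p b\<bar> < \<delta>"
      using assms(1) by (simp add: abs_less_iff field_simps)
    then show False using spaced ab by fastforce
  qed
  moreover have "?q ` S \<subseteq> {..nat \<lfloor>t / \<delta>\<rfloor>}"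
    using range assms(1)
    by (auto intro!: nat_mono floor_mono divide_right_mono simp: less_imp_le)
  ultimately show ?thesis
    by (metis card_atMost card_inj_on_le finite_atMost)
qed

text \<open>The bound \<open>B\<close> excludes the value \<infinity>. If \<open>w\<close> is
  -\<infinity>, as for a supremum over no observations, \<open>real_of_ereal\<close> returns 0,
  which is then the least nonnegative bound.\<close>

lemma least_nonneg_real_bound:
  assumes "w \<le> ereal B"
  shows "w \<le> ereal (max 0 (real_of_ereal w))"
    and "0 \<le> v \<Longrightarrow> w \<le> ereal v \<Longrightarrow> max 0 (real_of_ereal w) \<le> v"
  using assms by (cases w; simp)+

section \<open>The fixpoints of the combined map\<close>

locale tfa_network =
  fixes N :: "('n, 'f) network" and D :: "('n, 'f) local_maps"
  assumes wf: "well_formed N" and tfa: "tfa_local_maps N D"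
begin

abbreviation "Y \<equiv> burstiness_map N"
abbreviation "J \<equiv> jitter_map N D"
abbreviation "G \<equiv> combined_map N D"

lemma G_simp: "G (z, d) = (Y d, J z)"
  by (simp add: combined_map_def)

lemma bidx_flow:
  assumes "(l, f) \<in> bidx N"
  shows "rate N f > 0" "burst N f > 0" "\<And>u. u \<in> pred_nodes N f l \<Longrightarrow> (u, f) \<in> didx N"
    "fst l \<in> set (route N f)" "fst l \<in> nodes N"
proof -
  have f: "f \<in> flows N" "l \<in> hops (route N f)"
    using assms by (auto simp: bidx_def)
  show "rate N f > 0" "burst N f > 0"
    using f wf by (auto simp: well_formed_def)
  show "(u, f) \<in> didx N" if "u \<in> pred_nodes N f l" for u
    using that f by (auto simp: pred_nodes_def didx_def)
  show "fst l \<in> set (route N f)"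
    using f(2) by (cases l) (auto simp: hops_def dest: set_zip_leftD)
  then show "fst l \<in> nodes N"
    using f wf by (auto simp: well_formed_def)
qed

lemma finite_didx: "finite (didx N)"
proof -
  have "didx N = (\<Union>f\<in>flows N. (\<lambda>i. (i, f)) ` set (route N f))"
    by (auto simp: didx_def)
  then show ?thesis using wf by (simp add: well_formed_def)
qed

lemma finite_bidx: "finite (bidx N)"
proof -
  have "bidx N \<subseteq> (\<Union>f\<in>flows N. (\<lambda>l. (l, f)) ` hops (route N f))"
    by (auto simp: bidx_def)
  then show ?thesis
    using wf by (elim finite_subset) (simp add: well_formed_def hops_def)
qed

lemma bidx_in_subset: "bidx_in N i \<subseteq> bidx N"
  by (auto simp: bidx_in_def)

lemma restrict_bidx_in:
  "z \<in> nonneg_vectors (bidx N) \<Longrightarrow> restrict z (bidx_in N i) \<in> nonneg_vectors (bidx_in N i)"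
  using bidx_in_subset by (auto simp: nonneg_vectors_def PiE_iff)

lemma local_map:
  assumes "(i, f) \<in> didx N"
  shows "min_affine_on (bidx_in N i) (\<lambda>x. D i x f)"
    "isotonic_on (bidx_in N i) (\<lambda>x. D i x f)"
    "D i (zero_vector (bidx_in N i)) f > 0"
  using tfa assms by (auto simp: tfa_local_maps_def)

section \<open>Isotonicity and strict scaling of the two maps\<close>

lemma J_mono:
  assumes "z \<in> nonneg_vectors (bidx N)" "z' \<in> nonneg_vectors (bidx N)"
    and "\<And>k. k \<in> bidx N \<Longrightarrow> z k \<le> z' k" and k: "k \<in> didx N"
  shows "J z k \<le> J z' k"
proof -
  obtain i f where k': "k = (i, f)" by (cases k)
  have "D i (restrict z (bidx_in N i)) f \<le> D i (restrict z' (bidx_in N i)) f"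
    using assms bidx_in_subset[of i] k'
    by (intro isotonic_onD[OF local_map(2)] restrict_bidx_in) auto
  then show ?thesis using k k' by (simp add: jitter_map_def)
qed

lemma Y_mono:
  assumes "\<And>k. k \<in> didx N \<Longrightarrow> d k \<le> d' k" and k: "k \<in> bidx N"
  shows "Y d k \<le> Y d' k"
proof -
  obtain l f where k': "k = (l, f)" by (cases k)
  note * = bidx_flow[OF k[unfolded k']]
  have "(\<Sum>u\<in>pred_nodes N f l. d (u, f)) \<le> (\<Sum>u\<in>pred_nodes N f l. d' (u, f))"
    using assms(1) *(3) by (intro sum_mono) auto
  then show ?thesis using k k' *(1) by (simp add: burstiness_map_def)
qed

text \<open>Strictness comes from the term (1 - c) D(0) that concavity leaves over, which is
  positive because D(0) > 0.\<close>

lemma J_ray: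
  assumes z: "z \<in> nonneg_vectors (bidx N)" and z': "z' \<in> nonneg_vectors (bidx N)"
    and c: "0 \<le> c" "c < 1"
    and le: "\<And>k. k \<in> bidx N \<Longrightarrow> c * z' k \<le> z k" and k: "k \<in> didx N"
  shows "c * J z' k < J z k"
proof -
  obtain i f where k': "k = (i, f)" by (cases k)
  let ?K = "bidx_in N i" and ?g = "\<lambda>x. D i x f"
  note m = local_map[OF k[unfolded k']]
  have cz': "(\<lambda>k\<in>?K. c * restrict z' ?K k) \<in> nonneg_vectors ?K"
    using restrict_bidx_in[OF z', of i] c by (auto simp: nonneg_vectors_def PiE_iff)
  have "c * ?g (restrict z' ?K) < c * ?g (restrict z' ?K) + (1 - c) * ?g (zero_vector ?K)"
    using m(3) c by simp
  also have "\<dots> \<le> ?g (\<lambda>k\<in>?K. c * restrict z' ?K k)"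
    using min_affine_on_concave_ray[OF m(1) restrict_bidx_in[OF z']] c by simp
  also have "\<dots> \<le> ?g (restrict z ?K)"
    using le bidx_in_subset[of i]
    by (intro isotonic_onD[OF m(2) cz'] restrict_bidx_in[OF z]) auto
  finally show ?thesis using k k' by (simp add: jitter_map_def)
qed

text \<open>Here the slack is (1 - c) times the source burstiness.\<close>

lemma Y_ray:
  assumes "0 \<le> c" "c < 1" and le: "\<And>k. k \<in> didx N \<Longrightarrow> c * d' k \<le> d k" and k: "k \<in> bidx N"
  shows "c * Y d' k < Y d k"
proof -
  obtain l f where k': "k = (l, f)" by (cases k)
  note * = bidx_flow[OF k[unfolded k']]
  let ?S = "\<lambda>d. \<Sum>u\<in>pred_nodes N f l. d (u, f)"
  have "c * ?S d' \<le> ?S d"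
    unfolding sum_distrib_left using le *(3) by (intro sum_mono) auto
  then have "rate N f * (c * ?S d') \<le> rate N f * ?S d"
    using *(1) by simp
  moreover have "c * burst N f < burst N f" using assms(2) *(2) by simp
  ultimately show ?thesis using k k' by (simp add: burstiness_map_def algebra_simps)
qed

lemma J_nonneg:
  assumes z: "z \<in> nonneg_vectors (bidx N)"
  shows "J z \<in> nonneg_vectors (didx N)"
proof -
  have "0 \<le> J z k" if "k \<in> didx N" for k
    \<comment> \<open>For c = 0 the ray hypothesis only says that z is nonnegative, and the
      conclusion is positivity of \<open>J z\<close>.\<close>
    using J_ray[OF z z, of 0 k] that z by (auto simp: nonneg_vectors_def PiE_iff)
  then show ?thesis by (auto simp: nonneg_vectors_def PiE_iff jitter_map_def)
qed

lemma Y_nonneg: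
  assumes d: "d \<in> nonneg_vectors (didx N)"
  shows "Y d \<in> nonneg_vectors (bidx N)"
proof -
  have "0 \<le> Y d k" if "k \<in> bidx N" for k
    using Y_ray[of 0 d d k] that d by (auto simp: nonneg_vectors_def PiE_iff)
  then show ?thesis by (auto simp: nonneg_vectors_def PiE_iff burstiness_map_def)
qed

lemma G_states: "x \<in> states N \<Longrightarrow> G x \<in> states N"
  by (cases x) (auto simp: G_simp states_def J_nonneg Y_nonneg)

section \<open>Comparison of \<open>low N D\<close> with a fixpoint\<close>

lemma low_iff:
  "(z, d) \<in> low N D \<longleftrightarrow> (z, d) \<in> states N \<and>
     (\<forall>k\<in>bidx N. z k \<le> Y d k) \<and> (\<forall>k\<in>didx N. d k \<le> J z k)"
  by (simp add: low_def G_simp)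

lemma fixpoint_iff:
  "(z, d) \<in> fixpoint_states N D \<longleftrightarrow> (z, d) \<in> states N \<and> Y d = z \<and> J z = d"
  by (auto simp: fixpoint_states_def G_simp)

lemma low_le_fixpoint:
  assumes fp: "(z, d) \<in> fixpoint_states N D" and low: "(z', d') \<in> low N D"
  shows "\<forall>k\<in>bidx N. z' k \<le> z k" "\<forall>k\<in>didx N. d' k \<le> d k"
proof -
  have st: "z \<in> nonneg_vectors (bidx N)" "z' \<in> nonneg_vectors (bidx N)"
    "d \<in> nonneg_vectors (didx N)"
    using fp low by (auto simp: fixpoint_iff low_iff states_def)
  have eq: "Y d = z" "J z = d" using fp by (auto simp: fixpoint_iff)
  have le: "\<And>k. k \<in> bidx N \<Longrightarrow> z' k \<le> Y d' k" "\<And>k. k \<in> didx N \<Longrightarrow> d' k \<le> J z' k"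
    using low by (auto simp: low_iff)
  \<comment> \<open>The strict step for \<open>z\<close> uses the inequality for \<open>d\<close>,
    and conversely, so one factor c has to serve both. The two vectors are therefore glued over a
    disjoint sum.\<close>
  let ?x = "case_sum z d" and ?y = "case_sum z' d'"
  have "\<forall>k\<in>bidx N <+> didx N. ?y k \<le> ?x k"
  proof (rule ray_comparison)
    show "finite (bidx N <+> didx N)" using finite_bidx finite_didx by simp
    show "0 \<le> ?x k" if "k \<in> bidx N <+> didx N" for k
      using that st by (auto simp: nonneg_vectors_def PiE_iff)
    fix c :: real and k assume c: "0 \<le> c" "c < 1"
      and ray: "\<forall>j\<in>bidx N <+> didx N. c * ?y j \<le> ?x j" and k: "k \<in> bidx N <+> didx N"
    have ray': "\<And>j. j \<in> bidx N \<Longrightarrow> c * z' j \<le> z j" "\<And>j. j \<in> didx N \<Longrightarrow> c * d' j \<le> d j"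
      using ray[rule_format, OF InlI] ray[rule_format, OF InrI] by simp_all
    \<comment> \<open>The chain is c z' <= c Y(d') < Y(d) = z, and likewise for \<open>d\<close>
      below.\<close>
    have "c * z' j < z j" if "j \<in> bidx N" for j
      using Y_ray[OF c, of d' d j, OF ray'(2) that] mult_left_mono[OF le(1)[OF that] c(1)] eq by simp
    moreover have "c * d' j < d j" if "j \<in> didx N" for j
      using J_ray[OF st(1,2) c, of j, OF ray'(1) that] mult_left_mono[OF le(2)[OF that] c(1)] eq by simp
    ultimately show "c * ?y k < ?x k" using k by auto
  qed
  from this[rule_format, OF InlI] this[rule_format, OF InrI]
  show "\<forall>k\<in>bidx N. z' k \<le> z k" "\<forall>k\<in>didx N. d' k \<le> d k" by simp_all
qed

lemma fixpoint_in_low: "x \<in> fixpoint_states N D \<Longrightarrow> x \<in> low N D"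
  by (auto simp: fixpoint_states_def low_def)

text \<open>Both fixpoints lie in \<open>low N D\<close>, so each is below the other; extensionality
  turns agreement on the index sets into equality of functions.\<close>

lemma fixpoint_unique:
  assumes "x \<in> fixpoint_states N D" "y \<in> fixpoint_states N D"
  shows "x = y"
proof -
  obtain z d z' d' where xy: "x = (z, d)" "y = (z', d')" by (cases x, cases y)
  have ext: "z \<in> extensional (bidx N)" "z' \<in> extensional (bidx N)"
    "d \<in> extensional (didx N)" "d' \<in> extensional (didx N)"
    using assms xy by (auto simp: fixpoint_iff states_def nonneg_vectors_def PiE_iff)
  have low: "(z, d) \<in> low N D" "(z', d') \<in> low N D"
    using assms xy fixpoint_in_low by auto
  note le = low_le_fixpoint[OF assms(1)[unfolded xy] low(2)]
    low_le_fixpoint[OF assms(2)[unfolded xy] low(1)]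
  have "z = z'" "d = d'"
    using le by (intro extensionalityI[OF ext(1,2)] extensionalityI[OF ext(3,4)] antisym; blast)+
  then show ?thesis using xy by simp
qed

lemma fixpoint_imp_bounded:
  assumes "x \<in> fixpoint_states N D"
  shows "bounded_states N (low N D)"
proof -
  obtain z d where x: "(z, d) \<in> fixpoint_states N D" using assms by (cases x) auto
  \<comment> \<open>The inserted 0 keeps \<open>Max\<close> meaningful when there are no
    components.\<close>
  define B where "B = Max (insert 0 (z ` bidx N \<union> d ` didx N))"
  have B: "\<And>k. k \<in> bidx N \<Longrightarrow> z k \<le> B" "\<And>k. k \<in> didx N \<Longrightarrow> d k \<le> B"
    unfolding B_def using finite_bidx finite_didx by (auto intro!: Max_ge)
  have "\<bar>z' k\<bar> \<le> B" if "(z', d') \<in> low N D" "k \<in> bidx N" for z' d' k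
    using low_le_fixpoint(1)[OF x that(1)] B(1)[OF that(2)] that
    by (fastforce simp: low_iff states_def nonneg_vectors_def PiE_iff)
  moreover have "\<bar>d' k\<bar> \<le> B" if "(z', d') \<in> low N D" "k \<in> didx N" for z' d' k
    using low_le_fixpoint(2)[OF x that(1)] B(2)[OF that(2)] that
    by (fastforce simp: low_iff states_def nonneg_vectors_def PiE_iff)
  ultimately show ?thesis unfolding bounded_states_def by blast
qed

section \<open>The SyncTFA sequence\<close>

lemma J_tendsto:
  assumes X: "\<And>n. X n \<in> nonneg_vectors (bidx N)" and x: "x \<in> nonneg_vectors (bidx N)"
    and lim: "X \<longlonglongrightarrow> x"
  shows "(\<lambda>n. J (X n)) \<longlonglongrightarrow> J x"
proof (rule tendsto_funI)
  fix k
  show "(\<lambda>n. J (X n) k) \<longlonglongrightarrow> J x k"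
  proof (cases "k \<in> didx N")
    case True
    then obtain i f where k: "k = (i, f)" "(i, f) \<in> didx N" by (cases k) auto
    have "(\<lambda>n. D i (restrict (X n) (bidx_in N i)) f) \<longlonglongrightarrow> D i (restrict x (bidx_in N i)) f"
      by (intro min_affine_on_tendsto[OF local_map(1)[OF k(2)]] restrict_bidx_in X x)
        (simp add: tendsto_funD[OF lim])
    then show ?thesis using k by (simp add: jitter_map_def)
  qed (simp add: jitter_map_def)
qed

lemma Y_tendsto:
  assumes lim: "X \<longlonglongrightarrow> x"
  shows "(\<lambda>n. Y (X n)) \<longlonglongrightarrow> Y x"
proof -
  have "(\<lambda>n. X n k) \<longlonglongrightarrow> x k" for k
    using lim by (rule tendsto_funD)
  then have "(\<lambda>n. Y (X n) k) \<longlonglongrightarrow> Y x k" for k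
    by (cases "k \<in> bidx N"; cases k) (auto simp: burstiness_map_def intro!: tendsto_intros)
  then show ?thesis by (rule tendsto_funI)
qed

lemma sync_0: "sync_tfa N D 0 = (zero_vector (bidx N), zero_vector (didx N))"
  by (simp add: sync_tfa_def)

lemma sync_Suc: "sync_tfa N D (Suc n) = G (sync_tfa N D n)"
  by (simp add: sync_tfa_def)

lemma sync_states: "sync_tfa N D n \<in> states N"
proof (induction n)
  case 0
  then show ?case by (auto simp: sync_0 states_def zero_vector_def nonneg_vectors_def)
qed (simp add: sync_Suc G_states)

text \<open>Apply the isotonic map \<open>G\<close> to both sides of x <= G x.\<close>

lemma low_invariant:
  assumes "x \<in> low N D"
  shows "G x \<in> low N D"
proof -
  obtain z d where x: "x = (z, d)" "(z, d) \<in> low N D" using assms by (cases x) auto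
  have st: "(z, d) \<in> states N" "(Y d, J z) \<in> states N"
    using x G_states[of x] by (auto simp: low_iff G_simp)
  have "Y d k \<le> Y (J z) k" if "k \<in> bidx N" for k
    using x that by (intro Y_mono) (auto simp: low_iff)
  moreover have "J z k \<le> J (Y d) k" if "k \<in> didx N" for k
    using x st that by (intro J_mono) (auto simp: low_iff states_def)
  ultimately show ?thesis using x st by (simp add: G_simp low_iff)
qed

text \<open>Membership of the n-th iterate says that it is below the next one, so this is the
  monotonicity of the sequence; it also makes bounds on \<open>low N D\<close> apply to every
  iterate.\<close>

lemma sync_low: "sync_tfa N D n \<in> low N D"
proof (induction n)
  case 0
  have st: "(zero_vector (bidx N), zero_vector (didx N)) \<in> states N"
    using sync_states[of 0] by (simp add: sync_0)
  then show ?case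
    using G_states[OF st]
    by (auto simp: sync_0 low_iff G_simp states_def nonneg_vectors_def PiE_iff zero_vector_def)
qed (simp add: sync_Suc low_invariant)

text \<open>Pass to the limit in the recursion, using continuity of both maps. No boundedness is
  assumed, so the lemma also excludes convergence when there is no fixpoint.\<close>

lemma sync_limit_fixpoint:
  assumes lim: "sync_tfa N D \<longlonglongrightarrow> x"
  shows "x \<in> fixpoint_states N D"
proof -
  let ?z = "\<lambda>n. fst (sync_tfa N D n)" and ?d = "\<lambda>n. snd (sync_tfa N D n)"
  obtain z d where x: "x = (z, d)" by (cases x)
  have lims: "?z \<longlonglongrightarrow> z" "?d \<longlonglongrightarrow> d"
    using tendsto_fst[OF lim] tendsto_snd[OF lim] x by auto
  have st: "?z n \<in> nonneg_vectors (bidx N)" "?d n \<in> nonneg_vectors (didx N)" for n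
    using sync_states[of n] by (auto simp: states_def)
  have mem: "z \<in> nonneg_vectors (bidx N)" "d \<in> nonneg_vectors (didx N)"
    by (rule nonneg_vectors_closed[OF st(1) lims(1)] nonneg_vectors_closed[OF st(2) lims(2)])+
  have step: "?z (Suc n) = Y (?d n)" "?d (Suc n) = J (?z n)" for n
    by (cases "sync_tfa N D n"; simp add: sync_Suc G_simp)+
  have "(\<lambda>n. ?z (Suc n)) \<longlonglongrightarrow> Y d" "(\<lambda>n. ?d (Suc n)) \<longlonglongrightarrow> J z"
    unfolding step by (intro Y_tendsto J_tendsto lims st mem)+
  with LIMSEQ_Suc[OF lims(1)] LIMSEQ_Suc[OF lims(2)] have "Y d k = z k" "J z k' = d k'" for k k'
    unfolding tendsto_fun_iff by (metis LIMSEQ_unique)+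
  then show ?thesis using mem x by (auto simp: fixpoint_iff states_def)
qed

lemma bounded_imp_sync_convergent:
  assumes "bounded_states N (low N D)"
  shows "convergent (sync_tfa N D)"
proof -
  let ?z = "\<lambda>n. fst (sync_tfa N D n)" and ?d = "\<lambda>n. snd (sync_tfa N D n)"
  obtain B where B: "\<And>z d. (z, d) \<in> low N D \<Longrightarrow>
      (\<forall>k\<in>bidx N. \<bar>z k\<bar> \<le> B) \<and> (\<forall>k\<in>didx N. \<bar>d k\<bar> \<le> B)"
    using assms unfolding bounded_states_def by blast
  have bz: "?z n k \<le> B" if "k \<in> bidx N" for n k
    using that by (metis abs_le_D1 B prod.collapse sync_low)
  have bd: "?d n k \<le> B" if "k \<in> didx N" for n k
    using that by (metis abs_le_D1 B prod.collapse sync_low)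
  have iz: "?z n k \<le> ?z (Suc n) k" if "k \<in> bidx N" for n k
    using sync_low[of n] that by (simp add: low_def sync_Suc)
  have id: "?d n k \<le> ?d (Suc n) k" if "k \<in> didx N" for n k
    using sync_low[of n] that by (simp add: low_def sync_Suc)
  have st: "?z n \<in> nonneg_vectors (bidx N)" "?d n \<in> nonneg_vectors (didx N)" for n
    using sync_states[of n] by (auto simp: states_def)
  have "convergent ?z" "convergent ?d"
    using nonneg_vectors_bounded_incseq_convergent st iz id bz bd by metis+
  then obtain z d where "?z \<longlonglongrightarrow> z" "?d \<longlonglongrightarrow> d" unfolding convergent_def by blast
  from tendsto_Pair[OF this] show ?thesis unfolding convergent_def by auto
qed

section \<open>Validity\<close>

text \<open>Serialization separates successive exits by at least one bit time of the line, so only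
  finitely many bits can exit before t, however large the initial backlog is.\<close>

lemma observed_bits_bounded:
  assumes \<omega>: "\<omega> \<in> executions N" and k: "(l, f) \<in> bidx N" and v: "v \<le> t"
  shows "observed_bits \<omega> l f v \<le> Suc (nat \<lfloor>t / (1 / line N (fst l))\<rfloor>)"
proof -
  note * = bidx_flow[OF k]
  have line: "line N (fst l) > 0" using * wf by (auto simp: well_formed_def)
  have f: "f \<in> flows N" using k by (auto simp: bidx_def)
  have sp: "\<bar>leave \<omega> f m (fst l) - leave \<omega> f n (fst l)\<bar> \<ge> 1 / line N (fst l)"
    if "m \<in> bits \<omega> f" "n \<in> bits \<omega> f" "m \<noteq> n" for m n
  proof -
    have "(f, m) \<in> bits_at N \<omega> (fst l)" "(f, n) \<in> bits_at N \<omega> (fst l)"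
      using that f * by (auto simp: bits_at_def)
    moreover have "\<forall>(f, m) \<in> bits_at N \<omega> (fst l). \<forall>(g, n) \<in> bits_at N \<omega> (fst l).
           (f, m) \<noteq> (g, n) \<longrightarrow> \<bar>leave \<omega> f m (fst l) - leave \<omega> g n (fst l)\<bar> \<ge> 1 / line N (fst l)"
      using \<omega> *(5) by (auto simp: executions_def ports_ok_def)
    ultimately show ?thesis using that(3) by fast
  qed
  show ?thesis
    unfolding observed_bits_def of_nat_le_iff
    by (rule card_spaced_le[where p = "\<lambda>n. leave \<omega> f n (fst l)"])
      (use line sp v in auto)
qed

text \<open>Dropping the two nonnegative subtracted terms leaves a bit count, whose bound is uniform
  over executions and over the interval from u to v.\<close>

lemma worst_burstiness_finite:
  assumes "\<Omega> \<subseteq> executions N" "(l, f) \<in> bidx N"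
  shows "\<exists>B. worst_burstiness N \<Omega> t l f \<le> ereal B"
proof -
  let ?B = "real (Suc (nat \<lfloor>t / (1 / line N (fst l))\<rfloor>))"
  have "observed_bits \<omega> l f v - observed_bits \<omega> l f u - rate N f * (v - u) \<le> ?B"
    if "\<omega> \<in> \<Omega>" "u \<le> v" "v \<le> t" for \<omega> u v
  proof -
    have "observed_bits \<omega> l f v \<le> ?B"
      using observed_bits_bounded assms that by blast
    moreover have "0 \<le> observed_bits \<omega> l f u" by (simp add: observed_bits_def)
    moreover have "0 \<le> rate N f * (v - u)" using bidx_flow(1)[OF assms(2)] that by simp
    ultimately show ?thesis by linarith
  qed
  then have "worst_burstiness N \<Omega> t l f \<le> ereal ?B"
    unfolding worst_burstiness_def by (intro Sup_least) auto
  then show ?thesis by blast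
qed

lemma leave_ge_enter:
  assumes \<omega>: "\<omega> \<in> executions N" and k: "(i, f) \<in> didx N" and n: "n \<in> bits \<omega> f"
  shows "enter \<omega> f n i \<le> leave \<omega> f n i"
proof -
  have f: "f \<in> flows N" "i \<in> set (route N f)" using k by (auto simp: didx_def)
  have i: "i \<in> nodes N" using f wf by (auto simp: well_formed_def)
  \<comment> \<open>The maximum that defines the release time is meaningful because packets are
    finite.\<close>
  have "finite {m \<in> bits \<omega> f. packet \<omega> f m = packet \<omega> f n}"
    using \<omega> f by (auto simp: executions_def packets_ok_def)
  then have "finite {enter \<omega> f m i | m. m \<in> bits \<omega> f \<and> packet \<omega> f m = packet \<omega> f n}"
    by simp
  then have "enter \<omega> f n i \<le> release \<omega> f n i"
    unfolding release_def using n by (intro Max_ge) auto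
  also have "release \<omega> f n i \<le> leave \<omega> f n i"
    using \<omega> f i n by (auto simp: executions_def ports_ok_def bits_at_def)
  finally show ?thesis .
qed

text \<open>An observed bit enters at time 0 or later and exits by t, so its delay lies between 0
  and t. With no observation the supremum is -\<infinity> and the infimum \<infinity>, and both
  estimates still hold.\<close>

lemma delay_jitter_finite:
  assumes "\<Omega> \<subseteq> executions N" "(i, f) \<in> didx N"
  shows "\<exists>B. delay_jitter \<Omega> t i f \<le> ereal B"
proof -
  have "Sup (observed_delays \<Omega> t i f) \<le> ereal t"
    by (intro Sup_least) (auto simp: observed_delays_def)
  moreover have "0 \<le> Inf (observed_delays \<Omega> t i f)"
    using leave_ge_enter[OF _ assms(2)] assms(1)
    by (intro Inf_greatest) (auto simp: observed_delays_def)
  ultimately have "delay_jitter \<Omega> t i f \<le> ereal t - 0"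
    unfolding delay_jitter_def by (rule ereal_minus_mono)
  then show ?thesis by auto
qed

text \<open>
  The least nonnegative bounds \<open>(z, d)\<close> up to a finite time \<open>t\<close> are finite, whatever the initial
  state, and soundness of the two maps says that they belong to \<open>low N D\<close>.
\<close>

lemma worst_cases_in_low:
  assumes \<Omega>: "\<Omega> \<subseteq> executions N" and sound: "jitter_map_sound N \<Omega> D" "burstiness_map_sound N \<Omega>"
    and t: "0 \<le> t"
  shows "\<exists>(z, d) \<in> low N D. bounds_burstiness N \<Omega> t z \<and> bounds_jitter N \<Omega> t d"
proof -
  define z where "z = (\<lambda>(l, f)\<in>bidx N. max 0 (real_of_ereal (worst_burstiness N \<Omega> t l f)))"
  define d where "d = (\<lambda>(i, f)\<in>didx N. max 0 (real_of_ereal (delay_jitter \<Omega> t i f)))"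
  have st: "z \<in> nonneg_vectors (bidx N)" "d \<in> nonneg_vectors (didx N)"
    by (auto simp: z_def d_def nonneg_vectors_def split_def)
  have bz: "bounds_burstiness N \<Omega> t z"
    using worst_burstiness_finite[OF \<Omega>] least_nonneg_real_bound(1)
    by (fastforce simp: bounds_burstiness_def z_def)
  have bd: "bounds_jitter N \<Omega> t d"
    using delay_jitter_finite[OF \<Omega>] least_nonneg_real_bound(1)
    by (fastforce simp: bounds_jitter_def d_def)
  have bY: "bounds_burstiness N \<Omega> t (Y d)"
    using sound(2) t st bd by (auto simp: burstiness_map_sound_def)
  have bJ: "bounds_jitter N \<Omega> t (J z)"
    using sound(1) t st bz by (auto simp: jitter_map_sound_def)
  have "z k \<le> Y d k" if mem: "k \<in> bidx N" for k
  proof -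
    obtain l f where k: "k = (l, f)" by (cases k)
    obtain B where B: "worst_burstiness N \<Omega> t l f \<le> ereal B"
      using worst_burstiness_finite[OF \<Omega>] mem k by blast
    \<comment> \<open>\<open>Y d\<close> is a nonnegative bound on the worst cases, hence it
      dominates the least such bound \<open>z\<close>.\<close>
    have "0 \<le> Y d k" using Y_nonneg[OF st(2)] mem by (auto simp: nonneg_vectors_def PiE_iff)
    moreover have "worst_burstiness N \<Omega> t l f \<le> ereal (Y d k)"
      using bY mem k by (auto simp: bounds_burstiness_def)
    ultimately show ?thesis
      using least_nonneg_real_bound(2)[OF B] mem k by (simp add: z_def)
  qed
  moreover have "d k \<le> J z k" if mem: "k \<in> didx N" for k
  proof -
    obtain i f where k: "k = (i, f)" by (cases k)
    obtain B where B: "delay_jitter \<Omega> t i f \<le> ereal B"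
      using delay_jitter_finite[OF \<Omega>] mem k by blast
    have "0 \<le> J z k" using J_nonneg[OF st(1)] mem by (auto simp: nonneg_vectors_def PiE_iff)
    moreover have "delay_jitter \<Omega> t i f \<le> ereal (J z k)"
      using bJ mem k by (auto simp: bounds_jitter_def)
    ultimately show ?thesis
      using least_nonneg_real_bound(2)[OF B] mem k by (simp add: d_def)
  qed
  ultimately have "(z, d) \<in> low N D" using st by (simp add: low_iff states_def)
  then show ?thesis using bz bd by blast
qed

text \<open>The element of \<open>low N D\<close> that bounds the worst cases depends on t, whereas
  the fixpoint above it does not.\<close>

lemma fixpoint_valid:
  assumes \<Omega>: "\<Omega> \<subseteq> executions N" and sound: "jitter_map_sound N \<Omega> D" "burstiness_map_sound N \<Omega>"
    and fp: "(z, d) \<in> fixpoint_states N D"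
  shows "valid_jitter N \<Omega> d" "valid_burstiness N \<Omega> z"
proof -
  have "bounds_burstiness N \<Omega> t z \<and> bounds_jitter N \<Omega> t d" if t: "0 \<le> t" for t
  proof -
    obtain z' d' where low: "(z', d') \<in> low N D"
      and b: "bounds_burstiness N \<Omega> t z'" "bounds_jitter N \<Omega> t d'"
      using worst_cases_in_low[OF \<Omega> sound t] by blast
    have "worst_burstiness N \<Omega> t l f \<le> ereal (z (l, f))" if "(l, f) \<in> bidx N" for l f
    proof -
      have "worst_burstiness N \<Omega> t l f \<le> ereal (z' (l, f))"
        using b(1) that by (auto simp: bounds_burstiness_def)
      also have "\<dots> \<le> ereal (z (l, f))" using low_le_fixpoint(1)[OF fp low] that by simp
      finally show ?thesis .
    qed
    moreover have "delay_jitter \<Omega> t i f \<le> ereal (d (i, f))" if "(i, f) \<in> didx N" for i f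
    proof -
      have "delay_jitter \<Omega> t i f \<le> ereal (d' (i, f))"
        using b(2) that by (auto simp: bounds_jitter_def)
      also have "\<dots> \<le> ereal (d (i, f))" using low_le_fixpoint(2)[OF fp low] that by simp
      finally show ?thesis .
    qed
    ultimately show ?thesis by (auto simp: bounds_burstiness_def bounds_jitter_def)
  qed
  then show "valid_jitter N \<Omega> d" "valid_burstiness N \<Omega> z"
    by (auto simp: valid_jitter_def valid_burstiness_def)
qed

end

section \<open>The bounded and the unbounded case\<close>

theorem theorem1:
  fixes N :: "('n, 'f) network"
    and \<Omega> :: "('n, 'f) execution set"
    and D :: "('n, 'f) local_maps"
  assumes "well_formed N"
    and "locally_stable N"
    and "\<Omega> \<subseteq> executions N"
    and "tfa_local_maps N D"
    and "jitter_map_sound N \<Omega> D"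
    and "burstiness_map_sound N \<Omega>"
  shows "(bounded_states N (low N D) \<longrightarrow>
            (\<exists>zbar dbar.
               fixpoint_states N D = {(zbar, dbar)} \<and>
               valid_jitter N \<Omega> dbar \<and>
               valid_burstiness N \<Omega> zbar \<and>
               sync_tfa N D \<longlonglongrightarrow> (zbar, dbar))) \<and>
         (\<not> bounded_states N (low N D) \<longrightarrow>
            fixpoint_states N D = {} \<and>
            \<not> convergent (sync_tfa N D))"
proof -
  interpret tfa_network N D using assms(1,4) by unfold_locales
  show ?thesis
  proof (intro conjI impI)
    assume "bounded_states N (low N D)"
    then obtain x where lim: "sync_tfa N D \<longlonglongrightarrow> x"
      using bounded_imp_sync_convergent unfolding convergent_def by blast
    obtain zbar dbar where x: "x = (zbar, dbar)" by (cases x)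
    have fp: "(zbar, dbar) \<in> fixpoint_states N D"
      using sync_limit_fixpoint[OF lim] x by simp
    then have "fixpoint_states N D = {(zbar, dbar)}" using fixpoint_unique by blast
    then show "\<exists>zbar dbar. fixpoint_states N D = {(zbar, dbar)} \<and>
        valid_jitter N \<Omega> dbar \<and> valid_burstiness N \<Omega> zbar \<and> sync_tfa N D \<longlonglongrightarrow> (zbar, dbar)"
      using fixpoint_valid[OF assms(3,5,6) fp] lim x by blast
  next
    assume unbounded: "\<not> bounded_states N (low N D)"
    then show "fixpoint_states N D = {}" using fixpoint_imp_bounded by blast
    then show "\<not> convergent (sync_tfa N D)"
      using sync_limit_fixpoint unfolding convergent_def by blast
  qed
qed

end
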